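(* Let $\kappa$ be an uncountable regular cardinal and let $\Lambda=(G,X,Y)$ be a $\kappa$-unbalanced web, witnessed by $f:X\to\kappa$ and an injection $g:Y\to\kappa$. Then there exists an $X$--$Y$-separating set $S$ of vertices such that: (1) every vertex $s\in S$ either belongs to $X$, or there exists an in-fan $\mathcal P$ at $s$ consisting of paths in $G[RF^\circ(S)\cup\{s\}]$, all with initial vertices in $X$, such that $f[in[\mathcal P]]$ is stationary; (2) $S$ is not strongly popular, i.e. there is no $X$--$S$-warp $\mathcal P$ with $f[in[\mathcal P]]$ stationary; (3) $|S\setminus X|\le\kappa$.
   Context: Paths are simple directed paths with initial vertex $in(P)$ and, if finite, terminal vertex $ter(P)$; a single vertex is a path. An $X$--$Z$-path is a finite path with $in(P)\in X$, $ter(P)\in Z$; a set $S$ is $X$--$Y$-separating if it meets every $X$--$Y$-path. An $X$--$Z$-warp is a set of pairwise vertex-disjoint finite paths $P$ with $in(P)\in X$, $ter(P)\in Z$, $V(P)\cap(X\cup Z)=\{in(P),ter(P)\}$. For a set of paths $\mathcal P$, $in[\mathcal P]=\{in(P):P\in\mathcal P\}$. An in-fan at $s$ is a set of finite paths all terminating at $s$, any two of which share no vertex other than $s$. For $S\subseteq V(G)$ (with $Y$ playing the role of the target set): $RF(S)$ is the set of vertices $v$ such that every path from $v$ to a vertex of $Y$ meets $S$; $\mathcal E(S)$ is the set of $s\in S$ from which some path to $Y$ meets $S$ only in $s$; $RF^\circ(S)=RF(S)\setminus\mathcal E(S)$. $G[W]$ is the induced subdigraph. A subset of $\kappa$ is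 stationary if it meets every closed unbounded subset of $\kappa$. The web is $\kappa$-unbalanced (witnessed by $f,g$) if $f:X\to\kappa$, $g:Y\to\kappa$ is injective, $f[X]$ is stationary, and $f(in(P))>g(ter(P))$ for every $X$--$Y$-path $P$. *)

theory Defs
  imports "Graph_Theory.Vertex_Walk" "Graph_Theory.Digraph_Component"
begin

unbundle cardinal_syntax

text \<open>
  A cardinal \<open>\<kappa>\<close> is given by a cardinal order, as in the library. The elements of \<open>Field \<kappa>\<close>
  play the role of the ordinals below \<open>\<kappa>\<close>, and \<open>\<alpha> < \<beta>\<close> is written \<open>\<alpha> \<in> underS \<kappa> \<beta>\<close>.
\<close>

definition uncountable_regular_cardinal :: "'k rel \<Rightarrow> bool" where
  "uncountable_regular_cardinal \<kappa> \<longleftrightarrow> Card_order \<kappa> \<and> natLeq <o \<kappa> \<and> regularCard \<kappa>"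

text \<open>
  The condition that every \<open>\<alpha> < \<delta>\<close> lies strictly below some element of \<open>C\<close> below \<open>\<delta>\<close> says
  that \<open>\<delta>\<close> is zero or a limit with \<open>C \<inter> \<delta>\<close> unbounded in \<open>\<delta>\<close>; zero is excluded separately.
\<close>

definition closed_in_cardinal :: "'k rel \<Rightarrow> 'k set \<Rightarrow> bool" where
  "closed_in_cardinal \<kappa> C \<longleftrightarrow>
    (\<forall>\<delta>\<in>Field \<kappa>. underS \<kappa> \<delta> \<noteq> {} \<and>
       (\<forall>\<alpha>\<in>underS \<kappa> \<delta>. \<exists>\<gamma>\<in>C \<inter> underS \<kappa> \<delta>. \<alpha> \<in> underS \<kappa> \<gamma>) \<longrightarrow> \<delta> \<in> C)"

definition club :: "'k rel \<Rightarrow> 'k set \<Rightarrow> bool" where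
  "club \<kappa> C \<longleftrightarrow> C \<subseteq> Field \<kappa> \<and> closed_in_cardinal \<kappa> C \<and> cofinal C \<kappa>"

definition stationary :: "'k rel \<Rightarrow> 'k set \<Rightarrow> bool" where
  "stationary \<kappa> A \<longleftrightarrow> A \<subseteq> Field \<kappa> \<and> (\<forall>C. club \<kappa> C \<longrightarrow> A \<inter> C \<noteq> {})"

text \<open>
  Finite paths are nonempty lists of distinct vertices (\<open>vpath\<close>), with initial vertex \<open>hd p\<close>,
  terminal vertex \<open>last p\<close> and vertex set \<open>set p\<close>.
\<close>

definition path_between ::
    "('a, 'b) pre_digraph \<Rightarrow> 'a set \<Rightarrow> 'a set \<Rightarrow> 'a list \<Rightarrow> bool" where
  "path_between G X Z p \<longleftrightarrow> vpath p G \<and> hd p \<in> X \<and> last p \<in> Z"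

definition separating :: "('a, 'b) pre_digraph \<Rightarrow> 'a set \<Rightarrow> 'a set \<Rightarrow> 'a set \<Rightarrow> bool" where
  "separating G X Y S \<longleftrightarrow> (\<forall>p. path_between G X Y p \<longrightarrow> set p \<inter> S \<noteq> {})"

definition warp :: "('a, 'b) pre_digraph \<Rightarrow> 'a set \<Rightarrow> 'a set \<Rightarrow> 'a list set \<Rightarrow> bool" where
  "warp G X Z P \<longleftrightarrow>
    (\<forall>p\<in>P. path_between G X Z p \<and> set p \<inter> (X \<union> Z) = {hd p, last p}) \<and>
    (\<forall>p\<in>P. \<forall>q\<in>P. p \<noteq> q \<longrightarrow> set p \<inter> set q = {})"

definition in_fan :: "('a, 'b) pre_digraph \<Rightarrow> 'a \<Rightarrow> 'a list set \<Rightarrow> bool" where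
  "in_fan G s P \<longleftrightarrow>
    (\<forall>p\<in>P. vpath p G \<and> last p = s) \<and>
    (\<forall>p\<in>P. \<forall>q\<in>P. p \<noteq> q \<longrightarrow> set p \<inter> set q = {s})"

definition RF :: "('a, 'b) pre_digraph \<Rightarrow> 'a set \<Rightarrow> 'a set \<Rightarrow> 'a set" where
  "RF G Y S = {v \<in> verts G. \<forall>p. path_between G {v} Y p \<longrightarrow> set p \<inter> S \<noteq> {}}"

definition essential :: "('a, 'b) pre_digraph \<Rightarrow> 'a set \<Rightarrow> 'a set \<Rightarrow> 'a set" where
  "essential G Y S = {s \<in> S. \<exists>p. path_between G {s} Y p \<and> set p \<inter> S = {s}}"

definition RF_interior :: "('a, 'b) pre_digraph \<Rightarrow> 'a set \<Rightarrow> 'a set \<Rightarrow> 'a set" where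
  "RF_interior G Y S = RF G Y S - essential G Y S"

definition web :: "('a, 'b) pre_digraph \<Rightarrow> 'a set \<Rightarrow> 'a set \<Rightarrow> bool" where
  "web G X Y \<longleftrightarrow> wf_digraph G \<and> X \<subseteq> verts G \<and> Y \<subseteq> verts G"

definition unbalanced ::
    "'k rel \<Rightarrow> ('a, 'b) pre_digraph \<Rightarrow> 'a set \<Rightarrow> 'a set \<Rightarrow> ('a \<Rightarrow> 'k) \<Rightarrow> ('a \<Rightarrow> 'k) \<Rightarrow> bool" where
  "unbalanced \<kappa> G X Y f g \<longleftrightarrow>
    f \<in> X \<rightarrow> Field \<kappa> \<and> g \<in> Y \<rightarrow> Field \<kappa> \<and> inj_on g Y \<and> stationary \<kappa> (f ` X) \<and>
    (\<forall>p. path_between G X Y p \<longrightarrow> g (last p) \<in> underS \<kappa> (f (hd p)))"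

definition strongly_popular ::
    "'k rel \<Rightarrow> ('a, 'b) pre_digraph \<Rightarrow> 'a set \<Rightarrow> ('a \<Rightarrow> 'k) \<Rightarrow> 'a set \<Rightarrow> bool" where
  "strongly_popular \<kappa> G X f S \<longleftrightarrow> (\<exists>P. warp G X S P \<and> stationary \<kappa> (f ` hd ` P))"

end

theory Submission
  imports Defs
begin

text \<open>
  Call a vertex popular if it lies in \<open>X\<close> or is the end of an in-fan whose initial vertices have
  a stationary \<open>f\<close>-image, and let \<open>S\<close> consist of the popular vertices from which \<open>Y\<close> can be reached
  without meeting another popular vertex. Every \<open>X\<close>--\<open>Y\<close>-path meets \<open>S\<close> in its last popular vertex.

  The main point is that no disjoint family of \<open>X\<close>--\<open>S\<close>-paths has stationary \<open>f\<close>-image. Otherwise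
  continue each path to \<open>Y\<close> beyond its end in \<open>S\<close>, avoiding popular vertices. By unbalancedness
  and Fodor's lemma stationarily many continuations end in the same \<open>y\<close>, and pressing down again
  a stationary set of prefixes of continuations forms a fan at a vertex \<open>v\<close> that is not popular.
  In the family consisting of the paths followed by these prefixes, each vertex other than \<open>v\<close> is
  used at most twice, so the family can be thinned out to a stationary in-fan at \<open>v\<close>, which
  is absurd.

  Hence only nonstationarily many paths of a fan at \<open>s \<in> S\<close> meet \<open>S\<close> before \<open>s\<close>; the others
  stay in the interior. If \<open>S - X\<close> had more than \<open>\<kappa>\<close> elements, choose for each \<open>\<alpha> < \<kappa>\<close>
  recursively a path starting at level \<open>\<alpha>\<close> in one of the fans and disjoint from the earlier choices,
  whenever there is one. Some \<open>s \<in> S - X\<close> lies on none of the chosen paths, and by Fodor's lemma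
  the path of level \<open>\<alpha>\<close> in its fan is eligible for stationarily many \<open>\<alpha>\<close>. So the chosen paths form a
  disjoint stationary family.
\<close>

section \<open>Stationary sets\<close>

lemma finite_subsingleton:
  assumes "\<And>a b. a \<in> M \<Longrightarrow> b \<in> M \<Longrightarrow> a = b"
  shows "finite M"
proof (cases "M = {}")
  case False
  then obtain x where "x \<in> M" by blast
  then have "M \<subseteq> {x}" using assms by blast
  then show ?thesis using finite_subset by blast
qed simp

locale regular_uncountable =
  fixes \<kappa> :: "'k rel"
  assumes regular: "uncountable_regular_cardinal \<kappa>"
begin

section \<open>Bounds and suprema below an uncountable regular cardinal\<close>

abbreviation less_ord :: "'k \<Rightarrow> 'k \<Rightarrow> bool" (infix \<open>\<prec>\<close> 50) where
  "a \<prec> b \<equiv> a \<in> underS \<kappa> b"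

lemma card_order: "Card_order \<kappa>" and natLeq_less: "natLeq <o \<kappa>" and regularCard: "regularCard \<kappa>"
  using regular by (auto simp: uncountable_regular_cardinal_def)

lemma well_order: "Well_order \<kappa>"
  using card_order by (simp add: card_order_on_def)

lemma infinite_Field: "infinite (Field \<kappa>)"
proof -
  have "natLeq \<le>o \<kappa>" using natLeq_less ordLess_imp_ordLeq by blast
  then have "|Field natLeq| \<le>o |Field \<kappa>|" by (rule card_of_mono2)
  then show ?thesis by (rule card_of_ordLeq_infinite) (simp add: Field_natLeq)
qed

lemma less_Field: "a \<prec> b \<Longrightarrow> a \<in> Field \<kappa>" "a \<prec> b \<Longrightarrow> b \<in> Field \<kappa>"
  by (auto simp: underS_def Field_def)

lemma less_irrefl: "\<not> a \<prec> a"
  by (simp add: underS_def)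

lemma less_trans: "a \<prec> b \<Longrightarrow> b \<prec> c \<Longrightarrow> a \<prec> c"
  using well_order unfolding order_on_defs underS_def
  by (auto dest: transD antisymD)

lemma less_linear: "a \<in> Field \<kappa> \<Longrightarrow> b \<in> Field \<kappa> \<Longrightarrow> a \<prec> b \<or> a = b \<or> b \<prec> a"
  using well_order unfolding order_on_defs total_on_def underS_def by blast

lemma wf_less: "wf {(a, b). a \<prec> b}"
proof -
  have "{(a, b). a \<prec> b} = \<kappa> - Id" by (auto simp: underS_def)
  then show ?thesis using well_order by (simp add: well_order_on_def)
qed

lemma ex_greater: "a \<in> Field \<kappa> \<Longrightarrow> \<exists>b. a \<prec> b"
  using infinite_Card_order_limit[OF card_order infinite_Field] by (fastforce simp: underS_def)

lemma ex_greater2: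
  assumes "a \<in> Field \<kappa>" "b \<in> Field \<kappa>"
  shows "\<exists>c. a \<prec> c \<and> b \<prec> c"
  using assms less_linear less_trans ex_greater by metis

lemma cofinal_iff: "cofinal C \<kappa> \<longleftrightarrow> (\<forall>a\<in>Field \<kappa>. \<exists>b\<in>C. a \<prec> b)"
  unfolding cofinal_def underS_def by auto

text \<open>By regularity a cofinal subset has the cardinality of \<kappa>, so a smaller one is not
  cofinal.\<close>

lemma small_bounded:
  assumes "K \<subseteq> Field \<kappa>" "|K| <o \<kappa>"
  shows "\<exists>b\<in>Field \<kappa>. \<forall>k\<in>K. k \<prec> b"
proof -
  have "\<not> cofinal K \<kappa>"
    using assms regularCard not_ordLess_ordIso unfolding regularCard_def by blast
  then obtain a where a: "a \<in> Field \<kappa>" "\<forall>k\<in>K. \<not> a \<prec> k"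
    by (auto simp: cofinal_iff)
  \<comment> \<open>\<open>a\<close> is only a weak bound and may belong to \<open>K\<close>; any
    \<open>b\<close> above it is a strict one.\<close>
  obtain b where b: "a \<prec> b" using ex_greater a(1) by blast
  have "k \<prec> b" if "k \<in> K" for k
    using less_linear[of a k] a assms(1) b that less_trans by blast
  then show ?thesis using less_Field(2)[OF b] by blast
qed

lemma countable_bounded:
  fixes e :: "nat \<Rightarrow> 'k"
  assumes "range e \<subseteq> Field \<kappa>"
  shows "\<exists>b\<in>Field \<kappa>. \<forall>n. e n \<prec> b"
proof -
  have "|range e| \<le>o |UNIV :: nat set|" by (rule card_of_image)
  also have "|UNIV :: nat set| =o natLeq" by (rule card_of_nat)
  finally have "|range e| <o \<kappa>" using natLeq_less ordLeq_ordLess_trans by blast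
  from small_bounded[OF assms this] show ?thesis by blast
qed

lemma finite_bounded:
  assumes "finite K" "K \<subseteq> Field \<kappa>"
  shows "\<exists>b\<in>Field \<kappa>. \<forall>k\<in>K. k \<prec> b"
proof -
  have "|K| <o |Field \<kappa>|" using assms(1) infinite_Field
    by (intro finite_ordLess_infinite[OF card_of_Well_order card_of_Well_order])
      (auto simp: Field_card_of)
  also have "|Field \<kappa>| =o \<kappa>" using card_order card_of_Field_ordIso by blast
  finally show ?thesis using small_bounded assms(2) by blast
qed

text \<open>The least strict upper bound; for a strictly increasing sequence it is the supremum,
  hence a limit.\<close>

lemma ex_supremum:
  fixes e :: "nat \<Rightarrow> 'k"
  assumes "range e \<subseteq> Field \<kappa>"
  shows "\<exists>d\<in>Field \<kappa>. (\<forall>n. e n \<prec> d) \<and> (\<forall>a. a \<prec> d \<longrightarrow> (\<exists>n. \<not> e n \<prec> a))"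
proof -
  define U where "U = {b\<in>Field \<kappa>. \<forall>n. e n \<prec> b}"
  obtain b where "b \<in> U" using countable_bounded[OF assms] unfolding U_def by auto
  then have "\<exists>d\<in>U. \<forall>a. (a, d) \<in> {(a, b). a \<prec> b} \<longrightarrow> a \<notin> U"
    using wf_less[unfolded wf_eq_minimal] by blast
  then obtain d where d: "d \<in> U" "\<forall>a. a \<prec> d \<longrightarrow> a \<notin> U" by auto
  have "\<exists>n. \<not> e n \<prec> a" if "a \<prec> d" for a
    using d(2) that less_Field(1)[OF that] by (auto simp: U_def)
  then show ?thesis using d(1) unfolding U_def by blast
qed

section \<open>Closed unbounded sets\<close>

lemma closed_in_cardinalD:
  assumes "closed_in_cardinal \<kappa> C" "d \<in> Field \<kappa>" "underS \<kappa> d \<noteq> {}"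
    and "\<And>a. a \<prec> d \<Longrightarrow> \<exists>c\<in>C. c \<prec> d \<and> a \<prec> c"
  shows "d \<in> C"
  using assms unfolding closed_in_cardinal_def by blast

lemma closed_in_cardinalI:
  assumes "\<And>d. d \<in> Field \<kappa> \<Longrightarrow> underS \<kappa> d \<noteq> {} \<Longrightarrow>
    (\<And>a. a \<prec> d \<Longrightarrow> \<exists>c\<in>C. c \<prec> d \<and> a \<prec> c) \<Longrightarrow> d \<in> C"
  shows "closed_in_cardinal \<kappa> C"
  unfolding closed_in_cardinal_def using assms by blast

lemma club_Field: "club \<kappa> (Field \<kappa>)"
  unfolding club_def cofinal_iff closed_in_cardinal_def using ex_greater less_Field by blast

lemma club_tail:
  assumes C: "club \<kappa> C" and b: "b \<in> Field \<kappa>"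
  shows "club \<kappa> {c\<in>C. b \<prec> c}"
proof -
  have "closed_in_cardinal \<kappa> {c\<in>C. b \<prec> c}"
  proof (rule closed_in_cardinalI)
    fix d assume d: "d \<in> Field \<kappa>" "underS \<kappa> d \<noteq> {}"
      and lim: "\<And>a. a \<prec> d \<Longrightarrow> \<exists>c\<in>{c\<in>C. b \<prec> c}. c \<prec> d \<and> a \<prec> c"
    have "d \<in> C"
      using C lim by (intro closed_in_cardinalD[OF _ d]) (auto simp: club_def)
    moreover have "b \<prec> d" using d(2) lim less_trans by blast
    ultimately show "d \<in> {c\<in>C. b \<prec> c}" by blast
  qed
  moreover have "cofinal {c\<in>C. b \<prec> c} \<kappa>"
    unfolding cofinal_iff
  proof
    fix a assume "a \<in> Field \<kappa>"
    then obtain e where "a \<prec> e" "b \<prec> e" using ex_greater2 b by blast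
    moreover from this obtain c where "c \<in> C" "e \<prec> c"
      using C less_Field unfolding club_def cofinal_iff by blast
    ultimately show "\<exists>c\<in>{c\<in>C. b \<prec> c}. a \<prec> c" using less_trans by blast
  qed
  ultimately show ?thesis using C unfolding club_def by blast
qed

text \<open>A limit of the diagonal intersection is, for each \<open>c\<close> below it, a limit of
  its members above \<open>c\<close>, which lie in \<open>C c\<close>. For unboundedness, a sequence
  of length \<omega> is built so that its supremum is a limit of all the relevant \<open>C c\<close>
  at once.\<close>

lemma club_diagonal_intersection:
  assumes C: "\<And>c. c \<in> Field \<kappa> \<Longrightarrow> club \<kappa> (C c)"
  shows "club \<kappa> {d\<in>Field \<kappa>. \<forall>c. c \<prec> d \<longrightarrow> d \<in> C c}" (is "club \<kappa> ?D")
proof -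
  have "closed_in_cardinal \<kappa> ?D"
  proof (rule closed_in_cardinalI)
    fix d assume d: "d \<in> Field \<kappa>" "underS \<kappa> d \<noteq> {}"
      and lim: "\<And>a. a \<prec> d \<Longrightarrow> \<exists>c\<in>?D. c \<prec> d \<and> a \<prec> c"
    have "d \<in> C c" if c: "c \<prec> d" for c
    proof (rule closed_in_cardinalD[OF _ d])
      show "closed_in_cardinal \<kappa> (C c)" using C less_Field c unfolding club_def by blast
      fix a assume a: "a \<prec> d"
      \<comment> \<open>\<open>e\<close> is the larger of \<open>a\<close> and \<open>c\<close>, so
        a member above \<open>e\<close> is above \<open>a\<close> and belongs to
        \<open>C c\<close>.\<close>
      have "\<exists>e. e \<prec> d \<and> (a = e \<or> a \<prec> e) \<and> (c = e \<or> c \<prec> e)"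
        using less_linear[of a c] less_Field a c by blast
      then obtain e where "e \<prec> d" "a = e \<or> a \<prec> e" "c = e \<or> c \<prec> e" by blast
      moreover from this obtain c' where "c' \<in> ?D" "c' \<prec> d" "e \<prec> c'" using lim by blast
      ultimately show "\<exists>c'\<in>C c. c' \<prec> d \<and> a \<prec> c'" using less_trans by blast
    qed
    then show "d \<in> ?D" using d by blast
  qed
  moreover have "\<exists>d\<in>?D. b0 \<prec> d" if b0: "b0 \<in> Field \<kappa>" for b0
  proof -
    have "\<forall>c b. \<exists>x. c \<in> Field \<kappa> \<and> b \<in> Field \<kappa> \<longrightarrow> x \<in> C c \<and> b \<prec> x"
      using C unfolding club_def cofinal_iff by blast
    then obtain x where x: "\<And>c b. c \<in> Field \<kappa> \<Longrightarrow> b \<in> Field \<kappa> \<Longrightarrow> x c b \<in> C c \<and> b \<prec> x c b"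
      by metis
    \<comment> \<open>Fewer than \<kappa> many points \<open>x c b\<close> are involved, so
      regularity puts a single \<open>u\<close> above all of them.\<close>
    have "\<exists>u\<in>Field \<kappa>. b \<prec> u \<and> (\<forall>c. c \<prec> b \<longrightarrow> x c b \<prec> u)" if b: "b \<in> Field \<kappa>" for b
    proof -
      let ?K = "(\<lambda>c. x c b) ` underS \<kappa> b"
      have "|?K| \<le>o |underS \<kappa> b|" by (rule card_of_image)
      then have "|?K| <o \<kappa>" using card_of_underS[OF card_order b] ordLeq_ordLess_trans by blast
      moreover have "?K \<subseteq> Field \<kappa>" using x b less_Field by blast
      ultimately obtain u where u: "u \<in> Field \<kappa>" "\<forall>k\<in>?K. k \<prec> u"
        using small_bounded[of ?K] by blast
      obtain u' where u': "u \<prec> u'" "b \<prec> u'" using ex_greater2[OF u(1) b] by blast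
      then have "\<forall>c. c \<prec> b \<longrightarrow> x c b \<prec> u'" using u(2) less_trans by blast
      then show ?thesis using u' less_Field(2) by blast
    qed
    then obtain u where u: "\<And>b. b \<in> Field \<kappa> \<Longrightarrow> u b \<in> Field \<kappa>" "\<And>b. b \<in> Field \<kappa> \<Longrightarrow> b \<prec> u b"
      "\<And>b c. b \<in> Field \<kappa> \<Longrightarrow> c \<prec> b \<Longrightarrow> x c b \<prec> u b" by metis
    define e where "e n = (u ^^ n) b0" for n
    have e: "e n \<in> Field \<kappa>" for n by (induction n) (auto simp: e_def b0 u)
    have e_Suc: "e (Suc n) = u (e n)" for n by (simp add: e_def)
    have e_step: "e n \<prec> e (Suc n)" for n using u(2) e by (simp add: e_Suc)
    have e_mono: "a \<prec> e n \<Longrightarrow> n \<le> m \<Longrightarrow> a \<prec> e m" for a n m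
      by (rule nat_induct_at_least[of n m]) (auto intro: less_trans e_step)
    obtain d where d: "d \<in> Field \<kappa>" "\<And>n. e n \<prec> d" "\<And>a. a \<prec> d \<Longrightarrow> \<exists>n. \<not> e n \<prec> a"
      using ex_supremum[of e] e by blast
    have below: "\<exists>n. a \<prec> e n" if a: "a \<prec> d" for a
    proof -
      obtain n where "\<not> e n \<prec> a" using d(3)[OF a] by blast
      then have "a = e n \<or> a \<prec> e n" using less_linear[of a "e n"] e less_Field a by blast
      then show ?thesis using e_step less_trans by blast
    qed
    have "d \<in> C c" if c: "c \<prec> d" for c
    proof (rule closed_in_cardinalD[OF _ d(1)])
      show "closed_in_cardinal \<kappa> (C c)" using C less_Field c unfolding club_def by blast
      show "underS \<kappa> d \<noteq> {}" using c by blast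
      fix a assume "a \<prec> d"
      then obtain n m where n: "a \<prec> e n" "c \<prec> e m" using below c by blast
      then have nm: "a \<prec> e (max n m)" "c \<prec> e (max n m)" using e_mono by auto
      \<comment> \<open>This point of \<open>C c\<close> lies between two consecutive terms of
        \<open>e\<close>, so \<open>C c\<close> is unbounded in \<open>d\<close>.\<close>
      let ?x = "x c (e (max n m))"
      have "?x \<in> C c" "e (max n m) \<prec> ?x" using x e c less_Field by blast+
      moreover have "?x \<prec> e (Suc (max n m))" unfolding e_Suc using u(3) e nm(2) by blast
      ultimately show "\<exists>c'\<in>C c. c' \<prec> d \<and> a \<prec> c'" using nm(1) d(2) less_trans by blast
    qed
    then have "d \<in> ?D" using d(1) by blast
    moreover have "b0 \<prec> d" using d(2)[of 0] by (simp add: e_def)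
    ultimately show ?thesis by blast
  qed
  ultimately show ?thesis unfolding club_def cofinal_iff by blast
qed

text \<open>If each fibre missed a club \<open>C c\<close>, some \<open>a\<close> in
  \<open>A\<close> would lie in the diagonal intersection of these clubs. Then \<open>a\<close> is
  in \<open>C (h a)\<close>, although it belongs to the fibre of \<open>h a\<close>.\<close>

theorem Fodor:
  assumes A: "stationary \<kappa> A" and h: "\<And>a. a \<in> A \<Longrightarrow> h a \<prec> a"
  shows "\<exists>c. stationary \<kappa> {a\<in>A. h a = c}"
proof (rule ccontr)
  assume none: "\<not> ?thesis"
  have "\<forall>c. \<exists>C. club \<kappa> C \<and> {a\<in>A. h a = c} \<inter> C = {}"
    using none A unfolding stationary_def by blast
  then obtain C where C: "\<And>c. club \<kappa> (C c)" "\<And>c. {a\<in>A. h a = c} \<inter> C c = {}" by metis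
  obtain a where "a \<in> A" "\<And>c. c \<prec> a \<Longrightarrow> a \<in> C c"
    using A club_diagonal_intersection[of C] C(1) unfolding stationary_def by blast
  then show False using h[of a] C(2)[of "h a"] by blast
qed

section \<open>Tails, fibres and thinning of stationary sets\<close>

lemma stationary_subset_Field: "stationary \<kappa> A \<Longrightarrow> A \<subseteq> Field \<kappa>"
  by (simp add: stationary_def)

lemma stationary_mono: "stationary \<kappa> A \<Longrightarrow> A \<subseteq> B \<Longrightarrow> B \<subseteq> Field \<kappa> \<Longrightarrow> stationary \<kappa> B"
  unfolding stationary_def by blast

lemma stationary_tail:
  assumes "stationary \<kappa> A" "b \<in> Field \<kappa>"
  shows "stationary \<kappa> {a\<in>A. b \<prec> a}"
  unfolding stationary_def
proof (intro conjI allI impI)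
  show "{a\<in>A. b \<prec> a} \<subseteq> Field \<kappa>" using assms(1) stationary_subset_Field by blast
  fix C assume "club \<kappa> C"
  from club_tail[OF this assms(2)] show "{a\<in>A. b \<prec> a} \<inter> C \<noteq> {}"
    using assms(1) unfolding stationary_def by blast
qed

text \<open>A finite set has a strict upper bound, so its tail above that bound is empty and cannot
  be stationary.\<close>

lemma stationary_infinite:
  assumes "stationary \<kappa> A"
  shows "infinite A"
proof
  assume "finite A"
  then obtain b where "b \<in> Field \<kappa>" "\<forall>a\<in>A. a \<prec> b"
    using finite_bounded stationary_subset_Field assms by blast
  moreover from this have "{a\<in>A. b \<prec> a} = {}" using less_trans less_irrefl by blast
  ultimately have "stationary \<kappa> {}" using stationary_tail[OF assms] by metis
  then show False using club_Field unfolding stationary_def by blast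
qed

text \<open>Natural numbers are coded by elements \<open>e n\<close> with a common bound
  \<open>b\<close>. Above \<open>b\<close> the map sending \<open>a\<close> to
  \<open>e (h a)\<close> is regressive, so Fodor's lemma applies.\<close>

lemma stationary_nat_fibre:
  fixes h :: "'k \<Rightarrow> nat"
  assumes A: "stationary \<kappa> A"
  shows "\<exists>n. stationary \<kappa> {a\<in>A. h a = n}"
proof -
  obtain e :: "nat \<Rightarrow> 'k" where e: "inj e" "range e \<subseteq> Field \<kappa>"
    using infinite_Field infinite_countable_subset by blast
  then obtain b where b: "b \<in> Field \<kappa>" "\<And>n. e n \<prec> b" using countable_bounded by blast
  obtain c where c: "stationary \<kappa> {a\<in>{a\<in>A. b \<prec> a}. e (h a) = c}"
    using Fodor[OF stationary_tail[OF A b(1)], of "\<lambda>a. e (h a)"] b(2) less_trans by blast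
  then obtain a where "e (h a) = c" using stationary_infinite by fastforce
  then have "{a\<in>{a\<in>A. b \<prec> a}. e (h a) = c} \<subseteq> {a'\<in>A. h a' = h a}" using e(1) by (auto dest: injD)
  then show ?thesis using stationary_mono[OF c] stationary_subset_Field[OF A] by blast
qed

lemma stationary_split:
  assumes "stationary \<kappa> A"
  shows "stationary \<kappa> {a\<in>A. P a} \<or> stationary \<kappa> {a\<in>A. \<not> P a}"
proof -
  obtain n where n: "stationary \<kappa> {a\<in>A. (if P a then 0 else 1 :: nat) = n}"
    using stationary_nat_fibre[OF assms, of "\<lambda>a. if P a then 0 else 1"] by blast
  show ?thesis
  proof (cases "n = 0")
    case True
    then have "{a\<in>A. (if P a then 0 else 1 :: nat) = n} = {a\<in>A. P a}" by auto
    then show ?thesis using n by simp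
  next
    case False
    then have "{a\<in>A. (if P a then 0 else 1 :: nat) = n} \<subseteq> {a\<in>A. \<not> P a}" by auto
    then show ?thesis using stationary_mono[OF n] stationary_subset_Field[OF assms] by blast
  qed
qed

text \<open>A witness \<open>w a\<close> is chosen for each \<open>a\<close>; numbering
  \<open>W\<close> turns this choice into a function to the natural numbers, which is constant on a
  stationary set.\<close>

lemma stationary_finite_cover:
  assumes A: "stationary \<kappa> A" and "finite W" and "\<And>a. a \<in> A \<Longrightarrow> \<exists>w\<in>W. R w a"
  shows "\<exists>w\<in>W. stationary \<kappa> {a\<in>A. R w a}"
proof -
  obtain i :: "_ \<Rightarrow> nat" where i: "inj_on i W" using finite_imp_inj_to_nat_seg assms(2) by metis
  obtain w where w: "\<And>a. a \<in> A \<Longrightarrow> w a \<in> W \<and> R (w a) a" using assms(3) by metis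
  obtain n where n: "stationary \<kappa> {a\<in>A. i (w a) = n}" 
    using stationary_nat_fibre[OF A, of "\<lambda>a. i (w a)"] by blast
  then obtain a0 where a0: "a0 \<in> A" "i (w a0) = n" using stationary_infinite[OF n] not_finite_existsD by fastforce
  have "{a\<in>A. i (w a) = n} \<subseteq> {a\<in>A. R (w a0) a}"
  proof
    fix a assume a: "a \<in> {a\<in>A. i (w a) = n}"
    then have "w a = w a0" using a0 w by (intro inj_onD[OF i]) auto
    then show "a \<in> {a\<in>A. R (w a0) a}" using a w[of a] by auto
  qed
  then have "stationary \<kappa> {a\<in>A. R (w a0) a}"
    using stationary_mono[OF n] stationary_subset_Field[OF A] by blast
  then show ?thesis using a0 w by blast
qed

text \<open>The indices kept are those whose list meets no list of a smaller index outside
  \<open>v\<close>. If the others were stationary, Fodor's lemma would fix the smaller index, and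
  one vertex of its list would contradict \<open>thin\<close>.\<close>

lemma stationary_disjoint_refinement:
  fixes W :: "'k \<Rightarrow> 'a list"
  assumes A: "stationary \<kappa> A"
    and thin: "\<And>w. w \<noteq> v \<Longrightarrow> \<not> stationary \<kappa> {a\<in>A. w \<in> set (W a)}"
  shows "\<exists>B\<subseteq>A. stationary \<kappa> B \<and> (\<forall>a\<in>B. \<forall>b\<in>B. a \<noteq> b \<longrightarrow> set (W a) \<inter> set (W b) \<subseteq> {v})"
proof -
  define conflict where
    "conflict a \<longleftrightarrow> (\<exists>b\<in>A. b \<prec> a \<and> \<not> set (W a) \<inter> set (W b) \<subseteq> {v})" for a
  have "\<not> stationary \<kappa> {a\<in>A. conflict a}"
  proof
    assume st: "stationary \<kappa> {a\<in>A. conflict a}"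
    have "\<forall>a. \<exists>b. conflict a \<longrightarrow> b \<prec> a \<and> \<not> set (W a) \<inter> set (W b) \<subseteq> {v}"
      unfolding conflict_def by blast
    then obtain h where h: "\<And>a. conflict a \<Longrightarrow> h a \<prec> a"
      "\<And>a. conflict a \<Longrightarrow> \<not> set (W a) \<inter> set (W (h a)) \<subseteq> {v}" by metis
    obtain c where c: "stationary \<kappa> {a\<in>{a\<in>A. conflict a}. h a = c}"
      using Fodor[OF st, of h] h(1) by blast
    \<comment> \<open>All these lists meet the one finite list \<open>W c\<close> outside
      \<open>v\<close>.\<close>
    have "\<exists>w\<in>set (W c) - {v}. stationary \<kappa> {a\<in>{a\<in>{a\<in>A. conflict a}. h a = c}. w \<in> set (W a)}"
    proof (rule stationary_finite_cover[OF c])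
      fix a assume "a \<in> {a\<in>{a\<in>A. conflict a}. h a = c}"
      then show "\<exists>w\<in>set (W c) - {v}. w \<in> set (W a)" using h(2)[of a] by auto
    qed simp
    then obtain w where w: "w \<noteq> v"
      and st': "stationary \<kappa> {a\<in>{a\<in>{a\<in>A. conflict a}. h a = c}. w \<in> set (W a)}" by blast
    have "stationary \<kappa> {a\<in>A. w \<in> set (W a)}"
      using st' by (rule stationary_mono) (use stationary_subset_Field[OF A] in auto)
    then show False using thin[OF w] by blast
  qed
  then have st: "stationary \<kappa> {a\<in>A. \<not> conflict a}" using stationary_split[OF A] by blast
  have "set (W a) \<inter> set (W b) \<subseteq> {v}"
    if ab: "a \<in> {a\<in>A. \<not> conflict a}" "b \<in> {a\<in>A. \<not> conflict a}" "a \<noteq> b" for a b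
  proof -
    consider "a \<prec> b" | "b \<prec> a"
      using less_linear[of a b] ab stationary_subset_Field[OF A] by blast
    then show ?thesis using ab unfolding conflict_def by cases blast+
  qed
  then show ?thesis using st by (intro exI[of _ "{a\<in>A. \<not> conflict a}"]) blast
qed

text \<open>
  If some vertex other than the common end lies on stationarily many of the lists, cutting
  them there makes them shorter; otherwise they can be thinned out to a fan.
\<close>

lemma stationary_fan_of_prefixes:
  fixes Q :: "'k \<Rightarrow> 'a list"
  assumes A: "stationary \<kappa> A" and Q: "\<forall>a\<in>A. Q a \<noteq> [] \<and> last (Q a) = y"
  shows "\<exists>v B T. B \<subseteq> A \<and> stationary \<kappa> B \<and>
    (\<forall>a\<in>B. (\<exists>r. Q a = T a @ r) \<and> T a \<noteq> [] \<and> last (T a) = v) \<and>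
    (\<forall>a\<in>B. \<forall>b\<in>B. a \<noteq> b \<longrightarrow> set (T a) \<inter> set (T b) \<subseteq> {v})"
proof -
  \<comment> \<open>The cutting is an induction on a bound for the lengths. Such a bound exists on a
    stationary set of indices, where the length is constant.\<close>
  have bounded: "\<exists>v B T. B \<subseteq> A \<and> stationary \<kappa> B \<and>
    (\<forall>a\<in>B. (\<exists>r. Q a = T a @ r) \<and> T a \<noteq> [] \<and> last (T a) = v) \<and>
    (\<forall>a\<in>B. \<forall>b\<in>B. a \<noteq> b \<longrightarrow> set (T a) \<inter> set (T b) \<subseteq> {v})"
    if "stationary \<kappa> A" "\<forall>a\<in>A. Q a \<noteq> [] \<and> last (Q a) = y \<and> length (Q a) \<le> n"
    for n A y and Q :: "'k \<Rightarrow> 'a list"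
    using that
  proof (induction n arbitrary: A Q y)
    case 0
    obtain a where "a \<in> A" using stationary_infinite[OF 0(1)] by fastforce
    then have False using 0(2) by auto
    then show ?case ..
  next
    case (Suc n)
    show ?case
    proof (cases "\<exists>w. w \<noteq> y \<and> stationary \<kappa> {a\<in>A. w \<in> set (Q a)}")
      case True
      then obtain w where w: "w \<noteq> y" "stationary \<kappa> {a\<in>A. w \<in> set (Q a)}" by blast
      have "\<forall>a. \<exists>q r. a \<in> A \<and> w \<in> set (Q a) \<longrightarrow> Q a = q @ r \<and> q \<noteq> [] \<and> last q = w \<and> r \<noteq> []"
      proof
        fix a
        show "\<exists>q r. a \<in> A \<and> w \<in> set (Q a) \<longrightarrow> Q a = q @ r \<and> q \<noteq> [] \<and> last q = w \<and> r \<noteq> []"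
        proof (cases "a \<in> A \<and> w \<in> set (Q a)")
          case True
          then obtain q r where qr: "Q a = q @ w # r" using split_list by metis
          \<comment> \<open>As \<open>w\<close> differs from the last vertex \<open>y\<close>,
            something is cut off and the length bound drops.\<close>
          then have "r \<noteq> []" using Suc.prems(2) True w(1) by auto
          then have "Q a = (q @ [w]) @ r \<and> q @ [w] \<noteq> [] \<and> last (q @ [w]) = w \<and> r \<noteq> []"
            using qr by simp
          then show ?thesis by blast
        qed blast
      qed
      then obtain q r where qr: "\<And>a. a \<in> A \<Longrightarrow> w \<in> set (Q a) \<Longrightarrow>
        Q a = q a @ r a \<and> q a \<noteq> [] \<and> last (q a) = w \<and> r a \<noteq> []" by metis
      have "q a \<noteq> [] \<and> last (q a) = w \<and> length (q a) \<le> n"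
        if a: "a \<in> {a\<in>A. w \<in> set (Q a)}" for a
      proof -
        have "length (Q a) = length (q a) + length (r a)" "r a \<noteq> []" using qr[of a] a by auto
        moreover have "length (Q a) \<le> Suc n" using Suc.prems(2) a by blast
        ultimately show ?thesis using qr[of a] a by (cases "r a") auto
      qed
      then have "\<forall>a\<in>{a\<in>A. w \<in> set (Q a)}. q a \<noteq> [] \<and> last (q a) = w \<and> length (q a) \<le> n" by blast
      from Suc.IH[OF w(2) this] obtain v B T where B: "B \<subseteq> {a\<in>A. w \<in> set (Q a)}" "stationary \<kappa> B"
        and T: "\<forall>a\<in>B. (\<exists>r. q a = T a @ r) \<and> T a \<noteq> [] \<and> last (T a) = v"
          "\<forall>a\<in>B. \<forall>b\<in>B. a \<noteq> b \<longrightarrow> set (T a) \<inter> set (T b) \<subseteq> {v}"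
        by (elim exE conjE) (rule that)
      have "\<exists>r. Q a = T a @ r" if "a \<in> B" for a
        using qr[of a] T(1) B(1) that by (metis (no_types, lifting) append_assoc mem_Collect_eq subsetD)
      then have "B \<subseteq> A \<and> stationary \<kappa> B \<and>
        (\<forall>a\<in>B. (\<exists>r. Q a = T a @ r) \<and> T a \<noteq> [] \<and> last (T a) = v) \<and>
        (\<forall>a\<in>B. \<forall>b\<in>B. a \<noteq> b \<longrightarrow> set (T a) \<inter> set (T b) \<subseteq> {v})"
        using B T by blast
      then show ?thesis by blast
    next
      case False
      then obtain B where "B \<subseteq> A" "stationary \<kappa> B"
        "\<forall>a\<in>B. \<forall>b\<in>B. a \<noteq> b \<longrightarrow> set (Q a) \<inter> set (Q b) \<subseteq> {y}"
        using stationary_disjoint_refinement[OF Suc.prems(1), of y Q] by blast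
      then show ?thesis using Suc.prems(2) by (intro exI[of _ y] exI[of _ B] exI[of _ Q]) auto
    qed
  qed
  obtain n where n: "stationary \<kappa> {a\<in>A. length (Q a) = n}"
    using stationary_nat_fibre[OF A, of "\<lambda>a. length (Q a)"] by blast
  have "\<forall>a\<in>{a\<in>A. length (Q a) = n}. Q a \<noteq> [] \<and> last (Q a) = y \<and> length (Q a) \<le> n"
    using Q by auto
  from bounded[OF n this] obtain v B T where B: "B \<subseteq> {a\<in>A. length (Q a) = n}" "stationary \<kappa> B"
    and T: "\<forall>a\<in>B. (\<exists>r. Q a = T a @ r) \<and> T a \<noteq> [] \<and> last (T a) = v"
      "\<forall>a\<in>B. \<forall>b\<in>B. a \<noteq> b \<longrightarrow> set (T a) \<inter> set (T b) \<subseteq> {v}"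
    by (elim exE conjE) (rule that)
  have "B \<subseteq> A" using B(1) by blast
  then show ?thesis using B(2) T by (intro exI[of _ v] exI[of _ B] exI[of _ T] conjI)
qed

end

section \<open>Paths\<close>

lemma vpath_induce_subgraph:
  assumes p: "vpath p G" and sub: "set p \<subseteq> U"
  shows "vpath p (G \<restriction> U)"
proof -
  have "(u, v) \<in> arcs_ends (G \<restriction> U)" if uv: "(u, v) \<in> set (vwalk_arcs p)" for u v
  proof -
    have "u \<in> U" "v \<in> U" using arcs_in_vwalk_arcs[OF uv] sub by auto
    moreover have "(u, v) \<in> arcs_ends G" using p uv by (auto simp: vpath_def vwalk_def)
    ultimately show ?thesis by (auto simp: arcs_ends_def arc_to_ends_def)
  qed
  then show ?thesis using p sub by (auto simp: vpath_def vwalk_def)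
qed

text \<open>The joined walk may repeat vertices. Removing its cycles keeps both ends but possibly
  not all vertices, hence only an inclusion.\<close>

lemma vpath_join:
  assumes p: "vwalk p G" and q: "vwalk q G" and "last p = hd q"
  obtains r where "vpath r G" "hd r = hd p" "last r = last q" "set r \<subseteq> set p \<union> set q"
proof
  have pq: "p \<noteq> []" "q \<noteq> []" using p q by auto
  show "vpath (vwalk_to_vpath (p \<oplus> q)) G"
    using assms by (intro vwalk_to_vpath_vpath vwalk_joinI_vwalk')
  show "hd (vwalk_to_vpath (p \<oplus> q)) = hd p"
    using pq by (simp add: vwalk_to_vpath_hd vwalk_join_hd')
  show "last (vwalk_to_vpath (p \<oplus> q)) = last q"
    using pq assms by (simp add: vwalk_to_vpath_last vwalk_join_last)
  show "set (vwalk_to_vpath (p \<oplus> q)) \<subseteq> set p \<union> set q"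
    by (auto dest!: vwalk_to_vpath_subset simp: vwalk_join_def dest: list.set_sel(2)[OF pq(2)])
qed

lemma vpath_prefix: "vpath (q @ r) G \<Longrightarrow> q \<noteq> [] \<Longrightarrow> vpath q G"
  by (auto simp: vpath_def intro: vwalkI_append_l)

lemma vpath_suffix: "vpath (q @ r) G \<Longrightarrow> r \<noteq> [] \<Longrightarrow> vpath r G"
  by (auto simp: vpath_def intro: vwalkI_append_r)

text \<open>The initial segment up to \<open>w\<close> misses the last vertex because the vertices
  of a path are distinct.\<close>

lemma vpath_cut:
  assumes p: "vpath p G" and "w \<in> set p" "w \<noteq> last p"
  obtains q where "vpath q G" "hd q = hd p" "last q = w" "set q \<subseteq> set p - {last p}"
proof -
  obtain ys zs where p_eq: "p = ys @ w # zs" using split_list assms(2) by metis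
  then have "zs \<noteq> []" using assms(3) by auto
  then have last: "last p \<in> set zs" using p_eq by simp
  show thesis
  proof
    show "vpath (ys @ [w]) G" using p p_eq by (intro vpath_prefix[of "ys @ [w]" zs]) auto
    show "hd (ys @ [w]) = hd p" using p_eq by (cases ys) auto
    show "set (ys @ [w]) \<subseteq> set p - {last p}"
      using p p_eq last by (auto simp: vpath_def)
  qed simp
qed

section \<open>Unbalanced webs\<close>

locale unbalanced_web = regular_uncountable \<kappa> for \<kappa> :: "'k rel" +
  fixes G :: "('a, 'b) pre_digraph" and X Y :: "'a set" and f g :: "'a \<Rightarrow> 'k"
  assumes web: "web G X Y" and unbalanced: "unbalanced \<kappa> G X Y f g"
begin

text \<open>Fans at \<open>v\<close> are the case \<open>Z = D = {v}\<close>, disjoint families the case \<open>D = {}\<close>.\<close>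

definition path_family :: "('a, 'b) pre_digraph \<Rightarrow> 'a set \<Rightarrow> 'a set \<Rightarrow> 'k set \<Rightarrow> ('k \<Rightarrow> 'a list) \<Rightarrow> bool"
  where "path_family H Z D A F \<longleftrightarrow> stationary \<kappa> A \<and>
    (\<forall>a\<in>A. vpath (F a) H \<and> hd (F a) \<in> X \<and> f (hd (F a)) = a \<and> last (F a) \<in> Z) \<and>
    (\<forall>a\<in>A. \<forall>b\<in>A. a \<noteq> b \<longrightarrow> set (F a) \<inter> set (F b) \<subseteq> D)"

text \<open>Several paths may start at the same level of \<open>f\<close>; one is chosen for each
  level, so the stationary set of levels does not change.\<close>

lemma path_family_of_set:
  assumes "\<And>p. p \<in> P \<Longrightarrow> vpath p H \<and> hd p \<in> X \<and> last p \<in> Z"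
    and "\<And>p q. p \<in> P \<Longrightarrow> q \<in> P \<Longrightarrow> p \<noteq> q \<Longrightarrow> set p \<inter> set q \<subseteq> D"
    and "stationary \<kappa> (f ` hd ` P)"
  shows "\<exists>F. path_family H Z D (f ` hd ` P) F"
proof -
  have "\<forall>a\<in>f ` hd ` P. \<exists>p. p \<in> P \<and> f (hd p) = a" by blast
  then obtain F where F: "\<forall>a\<in>f ` hd ` P. F a \<in> P \<and> f (hd (F a)) = a" by metis
  \<comment> \<open>The level is recovered from the chosen path, so distinct levels have distinct
    paths.\<close>
  then have "a = b" if "a \<in> f ` hd ` P" "b \<in> f ` hd ` P" "F a = F b" for a b
    using that by metis
  then have "path_family H Z D (f ` hd ` P) F"
    unfolding path_family_def using F assms by meson
  then show ?thesis by blast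
qed

text \<open>Every path of a family ending in \<open>v\<close> contains \<open>v\<close>, so the
  inclusion of intersections in \<open>{v}\<close> is the equality required of a fan. The digraph
  \<open>H\<close> is arbitrary, so that induced subdigraphs are covered.\<close>

lemma ex_in_fan_iff:
  "(\<exists>P. in_fan H v P \<and> hd ` P \<subseteq> X \<and> stationary \<kappa> (f ` hd ` P)) \<longleftrightarrow>
   (\<exists>A F. path_family H {v} {v} A F)" (is "?L \<longleftrightarrow> ?R")
proof
  assume ?L
  then obtain P where P: "in_fan H v P" "hd ` P \<subseteq> X" "stationary \<kappa> (f ` hd ` P)" by blast
  have "\<exists>F. path_family H {v} {v} (f ` hd ` P) F"
    by (rule path_family_of_set) (use P in \<open>auto simp: in_fan_def\<close>)
  then show ?R by blast
next
  assume ?R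
  then obtain A F where AF: "path_family H {v} {v} A F" by blast
  have F: "vpath (F a) H" "hd (F a) \<in> X" "f (hd (F a)) = a" "last (F a) = v" if "a \<in> A" for a
    using AF that unfolding path_family_def by auto
  have "v \<in> set (F a)" if "a \<in> A" for a using F(1,4)[OF that] by (auto simp: vpath_def vwalk_def)
  moreover have "\<forall>a\<in>A. \<forall>b\<in>A. a \<noteq> b \<longrightarrow> set (F a) \<inter> set (F b) \<subseteq> {v}"
    using AF by (simp add: path_family_def)
  ultimately have "set (F a) \<inter> set (F b) = {v}" if "a \<in> A" "b \<in> A" "F a \<noteq> F b" for a b
    using that by (metis IntI empty_iff subset_singletonD)
  then have "in_fan H v (F ` A)" unfolding in_fan_def using F(1,4) by auto
  moreover have "f ` hd ` F ` A = A" using F(3) by force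
  ultimately show ?L using AF F(2) unfolding path_family_def by (intro exI[of _ "F ` A"]) auto
qed

section \<open>Popular vertices and the separator\<close>

definition popular :: "'a set" where
  "popular = X \<union> {v. \<exists>A F. path_family G {v} {v} A F}"

text \<open>This is the separator of the theorem; \<open>essential\<close> applied to
  \<open>popular\<close> asks for a path to \<open>Y\<close> that avoids all other popular
  vertices.\<close>

definition last_popular :: "'a set" where
  "last_popular = essential G Y popular"

lemma popular_subset_verts: "popular \<subseteq> verts G"
proof
  fix v assume "v \<in> popular"
  then consider "v \<in> X" | A F where "path_family G {v} {v} A F" unfolding popular_def by blast
  then show "v \<in> verts G"
  proof cases
    case 1
    then show ?thesis using web by (auto simp: web_def)
  next
    case 2
    then obtain a where "a \<in> A" using stationary_infinite[of A] unfolding path_family_def by fastforce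
    then have "vpath (F a) G" "last (F a) = v" using 2 unfolding path_family_def by auto
    then show ?thesis by (auto simp: vpath_def vwalk_def)
  qed
qed

lemma last_popular_subset: "last_popular \<subseteq> popular"
  by (auto simp: last_popular_def essential_def)

text \<open>The tail of \<open>p\<close> from its last popular vertex on witnesses that this vertex
  belongs to the separator.\<close>

lemma meets_last_popular:
  assumes p: "vpath p G" "last p \<in> Y" and "set p \<inter> popular \<noteq> {}"
  shows "set p \<inter> last_popular \<noteq> {}"
proof -
  obtain ys x zs where split: "p = ys @ x # zs" "x \<in> popular" "\<forall>z\<in>set zs. z \<notin> popular"
    using split_list_last_prop[of p "\<lambda>z. z \<in> popular"] assms(3) by blast
  have "vpath (x # zs) G" using p(1) split(1) vpath_suffix[of ys "x # zs"] by simp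
  then have "path_between G {x} Y (x # zs)" using p(2) split(1) by (simp add: path_between_def)
  then have "x \<in> last_popular"
    using split unfolding last_popular_def essential_def by fastforce
  then show ?thesis using split(1) by auto
qed

lemma separating_last_popular: "separating G X Y last_popular"
  unfolding separating_def path_between_def
proof (intro allI impI)
  fix p assume p: "vpath p G \<and> hd p \<in> X \<and> last p \<in> Y"
  then have "hd p \<in> set p \<inter> popular" by (auto simp: popular_def vpath_def vwalk_def)
  then show "set p \<inter> last_popular \<noteq> {}" using p by (intro meets_last_popular) auto
qed

section \<open>Disjoint families of paths into the separator\<close>

lemma no_stationary_warp: "\<not> path_family G last_popular {} A P"
proof
  assume fam: "path_family G last_popular {} A P"
  have A: "stationary \<kappa> A" using fam unfolding path_family_def by blast
  have P: "vpath (P a) G" "hd (P a) \<in> X" "f (hd (P a)) = a" "last (P a) \<in> last_popular"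
    if "a \<in> A" for a using fam that unfolding path_family_def by auto
  have P_disj: "set (P a) \<inter> set (P b) = {}" if "a \<in> A" "b \<in> A" "a \<noteq> b" for a b
    using fam that unfolding path_family_def by blast
  have P_ne: "P a \<noteq> []" if "a \<in> A" for a using P(1)[OF that] by (auto simp: vpath_def vwalk_def)
  have "\<forall>a\<in>A. \<exists>q. path_between G {last (P a)} Y q \<and> set q \<inter> popular = {last (P a)}"
    using P(4) unfolding last_popular_def essential_def by blast
  then obtain Q where Q: "\<And>a. a \<in> A \<Longrightarrow>
      vpath (Q a) G \<and> hd (Q a) = last (P a) \<and> last (Q a) \<in> Y \<and> set (Q a) \<inter> popular = {last (P a)}"
    unfolding path_between_def by (metis singletonD)
  \<comment> \<open>\<open>P a\<close> followed by \<open>Q a\<close> yields an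
    \<open>X\<close>--\<open>Y\<close>-path from level \<open>a\<close>, to which unbalancedness
    applies.\<close>
  have "g (last (Q a)) \<prec> a" if a: "a \<in> A" for a
  proof -
    have "vwalk (P a) G" "vwalk (Q a) G" "last (P a) = hd (Q a)"
      using P(1) Q a by (auto simp: vpath_def)
    then obtain r where "vpath r G" "hd r = hd (P a)" "last r = last (Q a)" by (rule vpath_join)
    then have "g (last r) \<prec> f (hd r)"
      using unbalanced P(2) Q a unfolding unbalanced_def path_between_def by metis
    then show ?thesis using \<open>hd r = _\<close> \<open>last r = _\<close> P(3) a by simp
  qed
  from Fodor[OF A this] obtain c where c: "stationary \<kappa> {a\<in>A. g (last (Q a)) = c}" by blast
  define A1 where "A1 = {a\<in>A. g (last (Q a)) = c}"
  have A1: "stationary \<kappa> A1" "A1 \<subseteq> A" using c by (auto simp: A1_def)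
  obtain a1 where "a1 \<in> A1" using stationary_infinite[OF A1(1)] by fastforce
  \<comment> \<open>Equal values of \<open>g\<close> mean equal end vertices, since \<open>g\<close>
    is injective on \<open>Y\<close>.\<close>
  then have Q_last: "last (Q a) = last (Q a1)" if "a \<in> A1" for a
    using that Q unbalanced unfolding unbalanced_def A1_def by (auto dest!: inj_onD)
  have Q_ne: "Q a \<noteq> []" if "a \<in> A" for a using Q[OF that] by (auto simp: vpath_def vwalk_def)
  have "\<forall>a\<in>A1. Q a \<noteq> [] \<and> last (Q a) = last (Q a1)" using Q_ne Q_last A1(2) by blast
  from stationary_fan_of_prefixes[OF A1(1) this] obtain v B T where B: "B \<subseteq> A1" "stationary \<kappa> B"
    and "\<forall>a\<in>B. (\<exists>r. Q a = T a @ r) \<and> T a \<noteq> [] \<and> last (T a) = v"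
    and "\<forall>a\<in>B. \<forall>b\<in>B. a \<noteq> b \<longrightarrow> set (T a) \<inter> set (T b) \<subseteq> {v}"
    by (elim exE conjE) (rule that)
  then have T: "\<And>a. a \<in> B \<Longrightarrow> (\<exists>r. Q a = T a @ r) \<and> T a \<noteq> [] \<and> last (T a) = v"
    and T_disj: "\<And>a b. a \<in> B \<Longrightarrow> b \<in> B \<Longrightarrow> a \<noteq> b \<Longrightarrow> set (T a) \<inter> set (T b) \<subseteq> {v}"
    by simp_all
  have BA: "B \<subseteq> A" using B(1) A1(2) by blast
  have T_sub: "set (T a) \<subseteq> set (Q a)" if "a \<in> B" for a using T[OF that] by auto
  have T_walk: "vwalk (T a) G" "hd (T a) = last (P a)" if a: "a \<in> B" for a
  proof -
    obtain r where r: "Q a = T a @ r" "T a \<noteq> []" using T[OF a] by blast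
    have "vpath (Q a) G" "hd (Q a) = last (P a)" using Q a BA by auto
    then show "vwalk (T a) G" "hd (T a) = last (P a)" using r vpath_prefix by (auto simp: vpath_def)
  qed
  \<comment> \<open>The only popular vertex of \<open>Q a\<close> is the end of \<open>P a\<close>.
    A popular \<open>v\<close> would thus lie on all the disjoint paths \<open>P a\<close>, leaving
    at most one index in \<open>B\<close>.\<close>
  have "v \<notin> popular"
  proof
    assume v: "v \<in> popular"
    have "v \<in> set (P a)" if "a \<in> B" for a
    proof -
      have "v \<in> set (Q a)" using T[OF that] T_sub[OF that] by auto
      then have "v = last (P a)" using Q v that BA by blast
      then show ?thesis using P_ne that BA by auto
    qed
    then have "finite B" using P_disj BA by (intro finite_subsingleton) blast
    then show False using stationary_infinite B(2) by blast
  qed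
  have "\<forall>a\<in>B. \<exists>w. vpath w G \<and> hd w = hd (P a) \<and> last w = v \<and> set w \<subseteq> set (P a) \<union> set (T a)"
  proof
    fix a assume a: "a \<in> B"
    have "vwalk (P a) G" using P(1) a BA by (auto simp: vpath_def)
    from vpath_join[OF this T_walk(1)[OF a]] show
      "\<exists>w. vpath w G \<and> hd w = hd (P a) \<and> last w = v \<and> set w \<subseteq> set (P a) \<union> set (T a)"
      using T_walk(2)[OF a] T[OF a] by metis
  qed
  then obtain W where W: "\<And>a. a \<in> B \<Longrightarrow>
      vpath (W a) G \<and> hd (W a) = hd (P a) \<and> last (W a) = v \<and> set (W a) \<subseteq> set (P a) \<union> set (T a)"
    by metis
  \<comment> \<open>A vertex other than \<open>v\<close> lies on at most one \<open>P a\<close> and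
    at most one \<open>T a\<close>, hence on at most two of the \<open>W a\<close>.\<close>
  have "\<not> stationary \<kappa> {a\<in>B. w \<in> set (W a)}" if w: "w \<noteq> v" for w
  proof -
    have "finite {a\<in>B. w \<in> set (P a)}"
      by (rule finite_subsingleton) (use P_disj BA in blast)
    moreover have "finite {a\<in>B. w \<in> set (T a)}"
      by (rule finite_subsingleton) (use T_disj w in blast)
    moreover have "{a\<in>B. w \<in> set (W a)} \<subseteq> {a\<in>B. w \<in> set (P a)} \<union> {a\<in>B. w \<in> set (T a)}"
      using W by blast
    ultimately have "finite {a\<in>B. w \<in> set (W a)}" using finite_subset by blast
    then show ?thesis using stationary_infinite by blast
  qed
  then have "\<exists>B'\<subseteq>B. stationary \<kappa> B' \<and>
      (\<forall>a\<in>B'. \<forall>b\<in>B'. a \<noteq> b \<longrightarrow> set (W a) \<inter> set (W b) \<subseteq> {v})"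
    by (rule stationary_disjoint_refinement[OF B(2)])
  then obtain B' where B': "B' \<subseteq> B" "stationary \<kappa> B'"
    "\<forall>a\<in>B'. \<forall>b\<in>B'. a \<noteq> b \<longrightarrow> set (W a) \<inter> set (W b) \<subseteq> {v}" by (elim exE conjE) (rule that)
  have "vpath (W a) G \<and> hd (W a) \<in> X \<and> f (hd (W a)) = a \<and> last (W a) \<in> {v}" if "a \<in> B'" for a
  proof -
    have "a \<in> B" "a \<in> A" using that B'(1) BA by auto
    then show ?thesis using W[of a] P[of a] by simp
  qed
  then have "path_family G {v} {v} B' W" unfolding path_family_def using B'(2,3) by blast
  then have "v \<in> popular" unfolding popular_def by blast
  then show False using \<open>v \<notin> popular\<close> by blast
qed

section \<open>The three properties of the separator\<close>

lemma not_strongly_popular: "\<not> strongly_popular \<kappa> G X f last_popular"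
proof
  assume "strongly_popular \<kappa> G X f last_popular"
  then obtain P where P: "warp G X last_popular P" "stationary \<kappa> (f ` hd ` P)"
    unfolding strongly_popular_def by blast
  have "\<exists>F. path_family G last_popular {} (f ` hd ` P) F"
    by (rule path_family_of_set) (use P in \<open>auto simp: warp_def path_between_def\<close>)
  then show False using no_stationary_warp by blast
qed

text \<open>Fan paths that meet the separator before \<open>s\<close> become disjoint when cut
  there, so \<open>no_stationary_warp\<close> makes their levels nonstationary. The remaining paths
  avoid the separator before \<open>s\<close>, which places their earlier vertices in the
  interior.\<close>

lemma interior_fan:
  assumes s: "s \<in> last_popular" "s \<notin> X"
  shows "\<exists>A F. path_family (G \<restriction> (RF_interior G Y last_popular \<union> {s})) {s} {s} A F"
proof -
  obtain A F where fam: "path_family G {s} {s} A F"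
    using s last_popular_subset unfolding popular_def by blast
  have A: "stationary \<kappa> A" using fam unfolding path_family_def by blast
  have F: "vpath (F a) G" "hd (F a) \<in> X" "f (hd (F a)) = a" "last (F a) = s" if "a \<in> A" for a
    using fam that unfolding path_family_def by auto
  have F_disj: "set (F a) \<inter> set (F b) \<subseteq> {s}" if "a \<in> A" "b \<in> A" "a \<noteq> b" for a b
    using fam that unfolding path_family_def by blast
  define B where "B = {a\<in>A. \<exists>w\<in>set (F a). w \<in> last_popular \<and> w \<noteq> s}"
  have "\<not> stationary \<kappa> B"
  proof
    assume B: "stationary \<kappa> B"
    have "\<forall>a\<in>B. \<exists>q. vpath q G \<and> hd q = hd (F a) \<and> last q \<in> last_popular \<and> set q \<subseteq> set (F a) - {s}"
    proof
      fix a assume "a \<in> B"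
      then obtain w where w: "a \<in> A" "w \<in> set (F a)" "w \<in> last_popular" "w \<noteq> s"
        unfolding B_def by blast
      then have "w \<noteq> last (F a)" using F(4) by auto
      from vpath_cut[OF F(1)[OF w(1)] w(2) this]
      show "\<exists>q. vpath q G \<and> hd q = hd (F a) \<and> last q \<in> last_popular \<and> set q \<subseteq> set (F a) - {s}"
        using w F(4)[OF w(1)] by metis
    qed
    then obtain q where q: "\<And>a. a \<in> B \<Longrightarrow>
      vpath (q a) G \<and> hd (q a) = hd (F a) \<and> last (q a) \<in> last_popular \<and> set (q a) \<subseteq> set (F a) - {s}"
      by metis
    have BA: "B \<subseteq> A" by (auto simp: B_def)
    have "vpath (q a) G \<and> hd (q a) \<in> X \<and> f (hd (q a)) = a \<and> last (q a) \<in> last_popular"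
      if "a \<in> B" for a using q[OF that] F[of a] BA that by auto
    moreover have "set (q a) \<inter> set (q b) \<subseteq> {}" if "a \<in> B" "b \<in> B" "a \<noteq> b" for a b
      using q that F_disj[of a b] BA by blast
    ultimately have "path_family G last_popular {} B q"
      unfolding path_family_def using B by blast
    then show False using no_stationary_warp by blast
  qed
  moreover define C where "C = {a\<in>A. \<not> (\<exists>w\<in>set (F a). w \<in> last_popular \<and> w \<noteq> s)}"
  ultimately have C: "stationary \<kappa> C"
    using stationary_split[OF A, of "\<lambda>a. \<exists>w\<in>set (F a). w \<in> last_popular \<and> w \<noteq> s"]
    unfolding B_def by blast
  have "vpath (F a) (G \<restriction> (RF_interior G Y last_popular \<union> {s}))" if a: "a \<in> C" for a
  proof (rule vpath_induce_subgraph)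
    have aA: "a \<in> A" and avoid: "\<And>w. w \<in> set (F a) \<Longrightarrow> w \<noteq> s \<Longrightarrow> w \<notin> last_popular"
      using a by (auto simp: C_def)
    show "vpath (F a) G" using F aA by blast
    show "set (F a) \<subseteq> RF_interior G Y last_popular \<union> {s}"
    proof
      fix w assume w: "w \<in> set (F a)"
      have "w \<in> RF_interior G Y last_popular" if ws: "w \<noteq> s"
      proof -
        have "w \<noteq> last (F a)" using ws F(4) aA by simp
        from vpath_cut[OF F(1)[OF aA] w this] obtain q where
          q: "vpath q G" "hd q = hd (F a)" "last q = w" "set q \<subseteq> set (F a) - {s}"
          using F(4)[OF aA] by metis
        \<comment> \<open>Prefixing \<open>p\<close> with the segment \<open>q\<close> gives an
          \<open>X\<close>--\<open>Y\<close>-path, which meets the separator; \<open>q\<close>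
          avoids it, so \<open>p\<close> meets it.\<close>
        have "set p \<inter> last_popular \<noteq> {}" if p: "path_between G {w} Y p" for p
        proof -
          have "vwalk q G" "vwalk p G" "last q = hd p"
            using q p by (auto simp: path_between_def vpath_def)
          then obtain r where r: "vpath r G" "hd r = hd q" "last r = last p" "set r \<subseteq> set q \<union> set p"
            by (rule vpath_join)
          have "path_between G X Y r"
            using r q(2) p F(2)[OF aA] by (simp add: path_between_def)
          then have "set r \<inter> last_popular \<noteq> {}"
            using separating_last_popular unfolding separating_def by blast
          then show ?thesis using r(4) q(4) avoid by blast
        qed
        moreover have "w \<in> verts G" using w F(1)[OF aA] by (auto simp: vpath_def vwalk_def)
        ultimately show ?thesis
          using avoid[OF w ws] by (auto simp: RF_interior_def RF_def essential_def)
      qed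
      then show "w \<in> RF_interior G Y last_popular \<union> {s}" by blast
    qed
  qed
  moreover have CA: "a \<in> A" if "a \<in> C" for a using that by (simp add: C_def)
  moreover have "\<forall>a\<in>C. \<forall>b\<in>C. a \<noteq> b \<longrightarrow> set (F a) \<inter> set (F b) \<subseteq> {s}"
    by (intro ballI impI F_disj CA)
  ultimately have "path_family (G \<restriction> (RF_interior G Y last_popular \<union> {s})) {s} {s} C F"
    unfolding path_family_def using C F by simp
  then show ?thesis by blast
qed

lemma card_last_popular: "|last_popular - X| \<le>o \<kappa>"
proof (rule ccontr)
  assume large: "\<not> |last_popular - X| \<le>o \<kappa>"
  have "\<forall>s\<in>last_popular - X. \<exists>A F. path_family G {s} {s} A F"
    using last_popular_subset unfolding popular_def by blast
  then obtain A F where fam: "\<And>s. s \<in> last_popular - X \<Longrightarrow> path_family G {s} {s} (A s) (F s)"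
    by metis
  have F: "vpath (F s a) G" "hd (F s a) \<in> X" "f (hd (F s a)) = a" "last (F s a) = s"
    if "s \<in> last_popular - X" "a \<in> A s" for s a
    using fam[OF that(1)] that(2) unfolding path_family_def by auto
  define candidate where "candidate p a s \<longleftrightarrow> s \<in> last_popular - X \<and> a \<in> A s \<and>
    (\<forall>b. b \<prec> a \<longrightarrow> set (F s a) \<inter> set (p b) = {})" for p :: "'k \<Rightarrow> 'a list" and a s
  \<comment> \<open>Whether a vertex is a candidate at \<open>a\<close> depends only on the values
    of \<open>p\<close> below \<open>a\<close>, so well-founded recursion applies. The empty list
    marks a level without candidates.\<close>
  have "\<exists>p. \<forall>a. (\<exists>s. candidate p a s \<and> p a = F s a) \<or> (\<nexists>s. candidate p a s) \<and> p a = []"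
  proof (rule dependent_wf_choice[OF wf_less])
    fix p q :: "'k \<Rightarrow> 'a list" and a r
    assume "\<And>z. (z, a) \<in> {(a, b). a \<prec> b} \<Longrightarrow> p z = q z"
    then have "candidate p a s \<longleftrightarrow> candidate q a s" for s unfolding candidate_def by auto
    then show "((\<exists>s. candidate p a s \<and> r = F s a) \<or> (\<nexists>s. candidate p a s) \<and> r = []) =
      ((\<exists>s. candidate q a s \<and> r = F s a) \<or> (\<nexists>s. candidate q a s) \<and> r = [])" by simp
  qed blast
  then obtain p where p: "\<And>a. (\<exists>s. candidate p a s \<and> p a = F s a) \<or> (\<nexists>s. candidate p a s) \<and> p a = []"
    by blast
  have "|set (p a)| \<le>o \<kappa>" for a
  proof -
    have "|set (p a)| \<le>o |Field \<kappa>|"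
      using infinite_Field by (intro ordLess_imp_ordLeq
          finite_ordLess_infinite[OF card_of_Well_order card_of_Well_order]) (auto simp: Field_card_of)
    then show ?thesis using card_of_Field_ordIso[OF card_order] ordLeq_ordIso_trans by blast
  qed
  moreover have "|Field \<kappa>| \<le>o \<kappa>"
    using card_of_Field_ordIso[OF card_order] ordIso_imp_ordLeq by blast
  \<comment> \<open>The chosen lists are finite and indexed by \<kappa>, so they cannot cover a set
    of more than \<kappa> vertices.\<close>
  ultimately have "|\<Union>a\<in>Field \<kappa>. set (p a)| \<le>o \<kappa>"
    by (intro card_of_UNION_ordLeq_infinite_Field[OF infinite_Field card_order]) auto
  then have "\<not> last_popular - X \<subseteq> (\<Union>a\<in>Field \<kappa>. set (p a))"
    using large card_of_mono1 ordLeq_transitive by blast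
  then obtain s where s: "s \<in> last_popular - X" "\<And>a. a \<in> Field \<kappa> \<Longrightarrow> s \<notin> set (p a)" by blast
  have As: "stationary \<kappa> (A s)" using fam[OF s(1)] unfolding path_family_def by blast
  have F_disj: "set (F s a) \<inter> set (F s b) \<subseteq> {s}" if "a \<in> A s" "b \<in> A s" "a \<noteq> b" for a b
    using fam[OF s(1)] that unfolding path_family_def by blast
  define blocked where "blocked a \<longleftrightarrow> (\<exists>b. b \<prec> a \<and> set (F s a) \<inter> set (p b) \<noteq> {})" for a
  \<comment> \<open>Otherwise Fodor's lemma fixes the blocking level \<open>c\<close>, and one
    vertex \<open>w\<close> of the finite list \<open>p c\<close> lies on stationarily many paths of
    the fan at \<open>s\<close>. Since \<open>s\<close> is on no chosen path, \<open>w\<close> is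
    not \<open>s\<close> and lies on at most one of them.\<close>
  have "\<not> stationary \<kappa> {a\<in>A s. blocked a}"
  proof
    assume st: "stationary \<kappa> {a\<in>A s. blocked a}"
    have "\<forall>a. \<exists>b. blocked a \<longrightarrow> b \<prec> a \<and> set (F s a) \<inter> set (p b) \<noteq> {}"
      unfolding blocked_def by blast
    then obtain h where h: "\<And>a. blocked a \<Longrightarrow> h a \<prec> a \<and> set (F s a) \<inter> set (p (h a)) \<noteq> {}"
      by metis
    obtain c where c: "stationary \<kappa> {a\<in>{a\<in>A s. blocked a}. h a = c}"
      using Fodor[OF st, of h] h by blast
    then obtain a0 where "blocked a0" "h a0 = c" using stationary_infinite not_finite_existsD by blast
    then have c_Field: "c \<in> Field \<kappa>" using h less_Field by blast
    have "\<exists>w\<in>set (p c). stationary \<kappa> {a\<in>{a\<in>{a\<in>A s. blocked a}. h a = c}. w \<in> set (F s a)}"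
    proof (rule stationary_finite_cover[OF c])
      fix a assume "a \<in> {a\<in>{a\<in>A s. blocked a}. h a = c}"
      then show "\<exists>w\<in>set (p c). w \<in> set (F s a)" using h[of a] by auto
    qed simp
    then obtain w where w: "w \<in> set (p c)"
      and st': "stationary \<kappa> {a\<in>{a\<in>{a\<in>A s. blocked a}. h a = c}. w \<in> set (F s a)}" by blast
    have "w \<noteq> s" using w s(2)[OF c_Field] by blast
    then have "finite {a\<in>{a\<in>{a\<in>A s. blocked a}. h a = c}. w \<in> set (F s a)}"
      by (intro finite_subsingleton) (use F_disj in blast)
    then show False using stationary_infinite[OF st'] by blast
  qed
  then have st: "stationary \<kappa> {a\<in>A s. \<not> blocked a}" using stationary_split[OF As] by blast
  define D where "D = {a\<in>Field \<kappa>. p a \<noteq> []}"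
  have D: "\<exists>s. candidate p a s \<and> p a = F s a" if "a \<in> D" for a using p[of a] that by (auto simp: D_def)
  \<comment> \<open>At an unblocked level \<open>s\<close> itself is a candidate, so a path was
    chosen there, possibly from the fan of another vertex.\<close>
  have "{a\<in>A s. \<not> blocked a} \<subseteq> D"
  proof
    fix a assume a: "a \<in> {a\<in>A s. \<not> blocked a}"
    then have "candidate p a s" using s(1) unfolding candidate_def blocked_def by blast
    then obtain s' where s': "candidate p a s'" "p a = F s' a" using p[of a] by blast
    then have "vpath (p a) G" using F(1) unfolding candidate_def by metis
    then show "a \<in> D" using a stationary_subset_Field[OF As] by (auto simp: D_def vpath_def vwalk_def)
  qed
  then have "stationary \<kappa> D" using stationary_mono[OF st] by (auto simp: D_def)
  moreover have "vpath (p a) G \<and> hd (p a) \<in> X \<and> f (hd (p a)) = a \<and> last (p a) \<in> last_popular"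
    if a: "a \<in> D" for a
  proof -
    obtain s' where s': "s' \<in> last_popular - X" "a \<in> A s'" "p a = F s' a"
      using D[OF a] unfolding candidate_def by blast
    then show ?thesis using F[of s' a] by auto
  qed
  moreover have "set (p a) \<inter> set (p b) \<subseteq> {}" if ab: "a \<in> D" "b \<in> D" "a \<noteq> b" for a b
  proof -
    \<comment> \<open>The path at the higher level was chosen disjoint from all those at lower
      levels.\<close>
    have "set (p a) \<inter> set (p b) = {}" if "a \<in> D" "b \<prec> a" for a b
      using D[OF that(1)] that(2) unfolding candidate_def by metis
    then show ?thesis using less_linear[of a b] ab unfolding D_def by blast
  qed
  ultimately have "path_family G last_popular {} D p" unfolding path_family_def by blast
  then show False using no_stationary_warp by blast
qed

end

theorem theorem8p4:
  fixes \<kappa> :: "'k rel"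
    and G :: "('a, 'b) pre_digraph"
    and X Y :: "'a set"
    and f g :: "'a \<Rightarrow> 'k"
  assumes "uncountable_regular_cardinal \<kappa>"
    and "web G X Y"
    and "unbalanced \<kappa> G X Y f g"
  shows "\<exists>S \<subseteq> verts G.
      separating G X Y S \<and>
      (\<forall>s\<in>S. s \<in> X \<or>
        (\<exists>P. in_fan (G \<restriction> (RF_interior G Y S \<union> {s})) s P \<and> hd ` P \<subseteq> X \<and>
             stationary \<kappa> (f ` hd ` P))) \<and>
      \<not> strongly_popular \<kappa> G X f S \<and>
      |S - X| \<le>o \<kappa>"
proof -
  interpret unbalanced_web \<kappa> G X Y f g
    using assms by unfold_locales
  show ?thesis
  proof (intro exI[of _ last_popular] conjI ballI)
    show "last_popular \<subseteq> verts G" using last_popular_subset popular_subset_verts by blast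
    fix s assume "s \<in> last_popular"
    then show "s \<in> X \<or> (\<exists>P. in_fan (G \<restriction> (RF_interior G Y last_popular \<union> {s})) s P \<and>
        hd ` P \<subseteq> X \<and> stationary \<kappa> (f ` hd ` P))"
      unfolding ex_in_fan_iff using interior_fan by blast
  qed (rule separating_last_popular not_strongly_popular card_last_popular)+
qed

end
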